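(* Let $p>3$ be a prime. Then $$\sum_{k=0}^{p-1}\frac{T_kH_k}{3^k}\equiv\frac{3+\left(\frac{p}{3}\right)}{2}-p\left(1+\left(\frac{p}{3}\right)\right)\pmod{p^2}.$$
   Context: For $n\in\{0,1,2,\ldots\}$, $T_n$ denotes the coefficient of $x^n$ in the expansion of $(1+x+x^2)^n$ (the central trinomial coefficient), and $H_n$ denotes the $n$th harmonic number: $H_0=0$ and $H_n=\sum_{j=1}^n 1/j$ for $n\ge1$. $\left(\frac{\cdot}{\cdot}\right)$ denotes the Legendre symbol. For rational numbers $a,b$ whose denominators are prime to $p$, $a\equiv b\pmod{p^2}$ means that $(a-b)/p^2$ is a rational number with denominator prime to $p$. *)

theory Defs
  imports "HOL-Computational_Algebra.Computational_Algebra" "HOL-Number_Theory.Number_Theory"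
begin

definition central_trinomial :: "nat \<Rightarrow> int" where
  "central_trinomial n = Polynomial.coeff ([:1, 1, 1:] ^ n) n"

(* HOL-Analysis's harm requires a real normed field, which excludes rat. *)
definition harmonic :: "nat \<Rightarrow> rat" where
  "harmonic n = (\<Sum>j = 1..n. 1 / of_nat j)"

(* quotient_of yields the fraction in lowest terms. *)
definition denom_prime_to :: "nat \<Rightarrow> rat \<Rightarrow> bool" where
  "denom_prime_to p a \<longleftrightarrow> coprime (snd (quotient_of a)) (int p)"

(* Congruence of rationals modulo p ^ r; it is meaningful only for rationals with
   denominators prime to p, which is therefore part of the relation. *)
definition rat_cong_pow :: "nat \<Rightarrow> nat \<Rightarrow> rat \<Rightarrow> rat \<Rightarrow> bool" where
  "rat_cong_pow p r a b \<longleftrightarrow>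
     denom_prime_to p a \<and> denom_prime_to p b \<and> denom_prime_to p ((a - b) / of_nat p ^ r)"

end

theory Submission
  imports Defs
begin

text \<open>
  Put \<open>b j = (2 j choose j) (- 1 / 3)^j\<close> and \<open>t n = T n / 3^n\<close>. Expanding
  \<open>1 + x + x^2 = (x - 1)^2 + 3 x\<close> gives \<open>t n = (\<Sum>j. b j (n choose j))\<close>; since
  \<open>b (j + 1) / b j\<close> is a simple rational function, the sum has the exact evaluation
  \<open>(\<Sum>k<n. t k H k) = (n H n / 2 - n) (3 t n + t (n - 1)) - 3 / 2 (t n - 1)\<close>.
  At \<open>n = p\<close> it remains to know \<open>T p\<close> and \<open>H (p - 1)\<close> modulo \<open>p\<close>, and \<open>T (p - 1)\<close> modulo \<open>p^2\<close>.

  For the latter let \<open>c i\<close> and \<open>q i\<close> be the coefficients of \<open>(1 + x + x^2)^(p - 1)\<close> and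
  \<open>(1 + x + x^2)^p\<close>. As \<open>q i = c i + c (i - 1) + c (i - 2)\<close>, the sum \<open>W\<close> of \<open>q i\<close> over \<open>i < p\<close> with
  \<open>i \<equiv> - p (mod 3)\<close> is a partial sum of the \<open>c i\<close>, and the symmetry of the \<open>c i\<close> turns this into
  \<open>T (p - 1) = \<epsilon> (3^(p - 1) - 2 W)\<close> with \<open>\<epsilon>\<close> the Legendre symbol. Differentiation gives
  \<open>i q i \<equiv> p (mod p^2)\<close> on that class, so \<open>p^2\<close> divides \<open>q i + q (p - i)\<close> and hence \<open>2 W\<close>.
\<close>

section \<open>Binomial expansion of the central trinomial coefficients\<close>

lemma central_trinomial_sum:
  "central_trinomial n = (\<Sum>j\<le>n. int (n choose j) * (int ((2 * j) choose j) * (- 1) ^ j * 3 ^ (n - j)))"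
proof -
  have split: "[:1, 1, 1:] = [:-1, 1:]\<^sup>2 + Polynomial.monom (3::int) 1"
    by (simp add: power2_eq_square monom_altdef)
  have "Polynomial.coeff (of_nat (n choose j) * ([:-1, 1:]\<^sup>2) ^ j * Polynomial.monom (3::int) 1 ^ (n - j)) n =
      int (n choose j) * (int ((2 * j) choose j) * (- 1) ^ j * 3 ^ (n - j))" if "j \<le> n" for j
  proof -
    \<comment> \<open>The factor \<open>x^(n - j)\<close> shifts the coefficient of
      \<open>x^n\<close> to that of \<open>x^j\<close> in \<open>(x - 1)^(2 j)\<close>, the middle
      one.\<close>
    have "of_nat (n choose j) * ([:-1, 1:]\<^sup>2) ^ j * Polynomial.monom (3::int) 1 ^ (n - j) =
        Polynomial.smult (int (n choose j)) (Polynomial.monom (3 ^ (n - j)) (n - j) * [:-1, 1:] ^ (2 * j))"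
      by (simp add: of_nat_poly monom_power mult.commute flip: power_mult)
    then show ?thesis
      using that by (simp add: coeff_monom_mult coeff_linear_poly_power mult_2)
  qed
  then show ?thesis
    unfolding central_trinomial_def split binomial_ring coeff_sum
    by (intro sum.cong) auto
qed

definition signed_cbinom :: "nat \<Rightarrow> rat" where
  "signed_cbinom j = of_nat ((2 * j) choose j) * (- 1 / 3) ^ j"

definition scaled_trinomial :: "nat \<Rightarrow> rat" where
  "scaled_trinomial n = of_int (central_trinomial n) / 3 ^ n"

text \<open>Binomials with \<open>j > n\<close> vanish, so the upper limit may be any
  \<open>N \<ge> n\<close>. A common limit for all \<open>n\<close> is what allows sums to be
  interchanged later.\<close>

lemma scaled_trinomial_sum:
  assumes "n \<le> N"
  shows "scaled_trinomial n = (\<Sum>j\<le>N. signed_cbinom j * of_nat (n choose j))"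
proof -
  have "scaled_trinomial n = (\<Sum>j\<le>n. signed_cbinom j * of_nat (n choose j))"
    unfolding scaled_trinomial_def signed_cbinom_def central_trinomial_sum of_int_sum sum_divide_distrib
  proof (intro sum.cong refl)
    fix j assume "j \<in> {..n}"
    then have "(3::rat) ^ n = 3 ^ (n - j) * 3 ^ j"
      by (simp flip: power_add)
    then show "of_int (int (n choose j) * (int ((2 * j) choose j) * (- 1) ^ j * 3 ^ (n - j))) / 3 ^ n =
        of_nat ((2 * j) choose j) * (- 1 / 3) ^ j * (of_nat (n choose j) :: rat)"
      by (simp add: power_divide del: divide_minus_left)
  qed
  also have "\<dots> = (\<Sum>j\<le>N. signed_cbinom j * of_nat (n choose j))"
    using assms by (intro sum.mono_neutral_left) auto
  finally show ?thesis .
qed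

text \<open>The ratio of consecutive central binomial coefficients, cleared of denominators.\<close>

lemma signed_cbinom_Suc:
  "3 * of_nat (Suc j) * signed_cbinom (Suc j) = - 2 * of_nat (2 * j + 1) * signed_cbinom j"
proof -
  have "Suc j * ((2 * Suc j) choose Suc j) = 2 * Suc j * ((2 * j + 1) choose j)"
    using Suc_times_binomial_eq[of "2 * j + 1" j] by simp
  moreover have "(2 * j + 1) choose j = (2 * j + 1) choose Suc j"
    using binomial_symmetric[of j "2 * j + 1"] by simp
  moreover have "Suc j * ((2 * j + 1) choose Suc j) = (2 * j + 1) * ((2 * j) choose j)"
    using Suc_times_binomial_eq[of "2 * j" j] by simp
  ultimately have "Suc j * ((2 * Suc j) choose Suc j) = 2 * ((2 * j + 1) * ((2 * j) choose j))"
    by (metis mult.assoc)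
  then have "of_nat (Suc j) * of_nat ((2 * Suc j) choose Suc j) =
      (2 * (of_nat (2 * j + 1) * of_nat ((2 * j) choose j)) :: rat)"
    by (metis of_nat_mult of_nat_numeral)
  then show ?thesis
    unfolding signed_cbinom_def by (simp add: field_simps del: of_nat_Suc binomial_Suc_Suc)
qed

section \<open>Exact evaluation of the harmonic sum\<close>

text \<open>This is \<open>(N - j) (N choose j) = (j + 1) (N choose (j + 1))\<close> for
  \<open>N = Suc m\<close>, rearranged to avoid subtraction.\<close>

lemma times_binomial_expand:
  "Suc m * (Suc m choose j) = Suc j * (Suc m choose Suc j) + j * (Suc m choose j)"
proof (cases j)
  case (Suc i)
  have "Suc m * (Suc m choose j) = Suc m * (m choose Suc i) + Suc m * (m choose i)"
    by (simp add: Suc algebra_simps)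
  then show ?thesis
    using Suc_times_binomial_eq[of m "Suc i"] Suc_times_binomial_eq[of m i]
    by (simp only: Suc mult.commute)
qed simp

text \<open>Both \<open>(m + 1) t m\<close> and \<open>(m + 1) t (m + 1)\<close> expand in the
  quantities \<open>(j + 1) (m + 1 choose (j + 1))\<close>. In the combination on the right, before
  halving, these get the weight \<open>4 b j + 3 b (j + 1)\<close>, which the recurrence reduces to
  \<open>2 b j / (j + 1)\<close>.\<close>

lemma sum_signed_cbinom_binomial:
  "(\<Sum>j\<le>m. signed_cbinom j * of_nat (Suc m choose Suc j)) =
     of_nat (Suc m) * (3 * scaled_trinomial (Suc m) + scaled_trinomial m) / 2"
proof -
  define c where "c j = (of_nat (Suc m choose j) :: rat)" for j
  have m: "of_nat (Suc m) * of_nat (m choose j) = of_nat (Suc j) * c (Suc j)" for j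
    unfolding c_def by (metis Suc_times_binomial_eq mult.commute of_nat_mult)
  have Sm: "of_nat (Suc m) * c j = of_nat (Suc j) * c (Suc j) + of_nat j * c j" for j
    unfolding c_def by (metis times_binomial_expand of_nat_mult of_nat_add)
  have c0: "c (Suc (Suc m)) = 0"
    unfolding c_def by (rule of_nat_eq_0_iff[THEN iffD2], rule binomial_eq_0) simp
  have 1: "of_nat (Suc m) * scaled_trinomial m = (\<Sum>j\<le>m. signed_cbinom j * (of_nat (Suc j) * c (Suc j)))"
    unfolding scaled_trinomial_sum[OF order_refl] sum_distrib_left m[symmetric]
    by (intro sum.cong) auto
  have "of_nat (Suc m) * scaled_trinomial (Suc m) =
      (\<Sum>j\<le>Suc m. signed_cbinom j * (of_nat (Suc j) * c (Suc j) + of_nat j * c j))"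
    unfolding scaled_trinomial_sum[OF order_refl] sum_distrib_left Sm[symmetric]
    by (intro sum.cong) (auto simp: c_def)
  also have "\<dots> = (\<Sum>j\<le>Suc m. signed_cbinom j * (of_nat (Suc j) * c (Suc j))) +
      (\<Sum>j\<le>Suc m. signed_cbinom j * (of_nat j * c j))"
    by (simp add: distrib_left sum.distrib del: of_nat_Suc sum.atMost_Suc)
  also have "(\<Sum>j\<le>Suc m. signed_cbinom j * (of_nat (Suc j) * c (Suc j))) =
      (\<Sum>j\<le>m. signed_cbinom j * (of_nat (Suc j) * c (Suc j)))"
    by (simp add: c0)
  also have "(\<Sum>j\<le>Suc m. signed_cbinom j * (of_nat j * c j)) =
      (\<Sum>j\<le>m. signed_cbinom (Suc j) * (of_nat (Suc j) * c (Suc j)))"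
    by (subst sum.atMost_Suc_shift) (simp del: of_nat_Suc)
  finally have 2: "of_nat (Suc m) * scaled_trinomial (Suc m) =
      (\<Sum>j\<le>m. signed_cbinom j * (of_nat (Suc j) * c (Suc j))) +
      (\<Sum>j\<le>m. signed_cbinom (Suc j) * (of_nat (Suc j) * c (Suc j)))" .
  have "of_nat (Suc m) * (3 * scaled_trinomial (Suc m) + scaled_trinomial m) =
      3 * (of_nat (Suc m) * scaled_trinomial (Suc m)) + of_nat (Suc m) * scaled_trinomial m"
    by (simp only: distrib_left mult.left_commute)
  also have "\<dots> =
      (\<Sum>j\<le>m. 4 * of_nat (Suc j) * signed_cbinom j * c (Suc j) +
        3 * of_nat (Suc j) * signed_cbinom (Suc j) * c (Suc j))"
    unfolding 1 2 distrib_left sum_distrib_left add.assoc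
    by (simp add: sum.distrib[symmetric] algebra_simps del: of_nat_Suc)
  also have "\<dots> = (\<Sum>j\<le>m. 2 * (signed_cbinom j * c (Suc j)))"
    unfolding signed_cbinom_Suc by (intro sum.cong) (auto simp: algebra_simps)
  finally show ?thesis
    unfolding c_def by (simp add: sum_distrib_left[symmetric])
qed

text \<open>The recurrence, solved for \<open>b j / (j + 1)\<close>, splits the sum into the
  previous one and a shifted one; the latter is the expansion of \<open>t (m + 1)\<close> without
  its initial term 1.\<close>

lemma sum_signed_cbinom_binomial_div:
  "(\<Sum>j\<le>m. signed_cbinom j * of_nat (Suc m choose Suc j) / of_nat (Suc j)) =
     of_nat (Suc m) * (3 * scaled_trinomial (Suc m) + scaled_trinomial m) +
     3 / 2 * (scaled_trinomial (Suc m) - 1)"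
proof -
  have div: "signed_cbinom j / of_nat (Suc j) = 2 * signed_cbinom j + 3 / 2 * signed_cbinom (Suc j)" for j
    using signed_cbinom_Suc[of j] by (simp add: field_simps)
  have "(\<Sum>j\<le>m. signed_cbinom j * of_nat (Suc m choose Suc j) / of_nat (Suc j)) =
      (\<Sum>j\<le>m. (2 * signed_cbinom j + 3 / 2 * signed_cbinom (Suc j)) * of_nat (Suc m choose Suc j))"
    unfolding div[symmetric] by (intro sum.cong) auto
  also have "\<dots> = 2 * (\<Sum>j\<le>m. signed_cbinom j * of_nat (Suc m choose Suc j)) +
      3 / 2 * (\<Sum>j\<le>m. signed_cbinom (Suc j) * of_nat (Suc m choose Suc j))"
    by (simp add: distrib_right sum.distrib sum_distrib_left mult.assoc del: binomial_Suc_Suc)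
  also have "(\<Sum>j\<le>m. signed_cbinom (Suc j) * of_nat (Suc m choose Suc j)) = scaled_trinomial (Suc m) - 1"
    unfolding scaled_trinomial_sum[OF order_refl] sum.atMost_Suc_shift
    by (simp add: signed_cbinom_def del: binomial_Suc_Suc)
  finally show ?thesis
    unfolding sum_signed_cbinom_binomial by simp
qed

lemma harmonic_Suc: "harmonic (Suc n) = harmonic n + 1 / of_nat (Suc n)"
  by (simp add: harmonic_def)

text \<open>Summation by parts. The induction step rests on
  \<open>(n + 1 choose (j + 1)) / (n + 1) = (n choose j) / (j + 1)\<close>.\<close>

lemma sum_binomial_harmonic:
  "(\<Sum>k<n. of_nat (k choose j) * harmonic k) =
     of_nat (n choose Suc j) * (harmonic n - 1 / of_nat (Suc j))"
proof (induction n)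
  case (Suc n)
  have "of_nat (Suc j) * of_nat (Suc n choose Suc j) = (of_nat (Suc n) * of_nat (n choose j) :: rat)"
    by (metis Suc_times_binomial_eq mult.commute of_nat_mult)
  then have "of_nat (Suc n choose Suc j) / of_nat (Suc n) = (of_nat (n choose j) / of_nat (Suc j) :: rat)"
    by (simp add: field_simps)
  moreover have "of_nat (Suc n choose Suc j) * (harmonic (Suc n) - 1 / of_nat (Suc j)) =
      of_nat (Suc n choose Suc j) * (harmonic n - 1 / of_nat (Suc j)) +
      of_nat (Suc n choose Suc j) / of_nat (Suc n)"
    by (simp add: harmonic_Suc algebra_simps del: binomial_Suc_Suc of_nat_Suc)
  ultimately show ?case
    using Suc by (simp add: algebra_simps del: of_nat_Suc)
qed simp

text \<open>After exchanging summations, the two terms of \<open>sum_binomial_harmonic\<close> lead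
  to the two sums just evaluated.\<close>

lemma sum_scaled_trinomial_harmonic:
  "(\<Sum>k<Suc m. scaled_trinomial k * harmonic k) =
     (of_nat (Suc m) * harmonic (Suc m) / 2 - of_nat (Suc m)) * (3 * scaled_trinomial (Suc m) + scaled_trinomial m)
     - 3 / 2 * (scaled_trinomial (Suc m) - 1)"
proof -
  have "(\<Sum>k<Suc m. scaled_trinomial k * harmonic k) =
      (\<Sum>k<Suc m. \<Sum>j\<le>m. signed_cbinom j * (of_nat (k choose j) * harmonic k))"
    by (intro sum.cong refl, subst scaled_trinomial_sum[of _ m]) (auto simp: sum_distrib_right mult.assoc)
  also have "\<dots> = (\<Sum>j\<le>m. signed_cbinom j * (\<Sum>k<Suc m. of_nat (k choose j) * harmonic k))"
    by (subst sum.swap) (simp only: sum_distrib_left)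
  also have "\<dots> = harmonic (Suc m) * (\<Sum>j\<le>m. signed_cbinom j * of_nat (Suc m choose Suc j)) -
      (\<Sum>j\<le>m. signed_cbinom j * of_nat (Suc m choose Suc j) / of_nat (Suc j))"
    unfolding sum_binomial_harmonic sum_distrib_left sum_subtractf[symmetric]
    by (intro sum.cong refl) (simp add: right_diff_distrib del: binomial_Suc_Suc of_nat_Suc)
  finally show ?thesis
    unfolding sum_signed_cbinom_binomial sum_signed_cbinom_binomial_div
    by (simp add: algebra_simps del: of_nat_Suc)
qed

section \<open>Coefficients of the powers of 1 + x + x^2\<close>

definition trinomial_coeff :: "nat \<Rightarrow> nat \<Rightarrow> int" where
  "trinomial_coeff n i = Polynomial.coeff ([:1, 1, 1:] ^ n) i"

lemma trinomial_coeff_0_right [simp]: "trinomial_coeff n 0 = 1"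
  by (simp add: trinomial_coeff_def coeff_0_power)

lemma trinomial_coeff_Suc_1: "trinomial_coeff (Suc n) (Suc 0) = trinomial_coeff n (Suc 0) + 1"
  using trinomial_coeff_0_right[of n] by (simp add: trinomial_coeff_def)

lemma trinomial_coeff_Suc_Suc:
  "trinomial_coeff (Suc n) (Suc (Suc i)) =
     trinomial_coeff n (Suc (Suc i)) + trinomial_coeff n (Suc i) + trinomial_coeff n i"
  by (simp add: trinomial_coeff_def)

lemma degree_trinomial_power: "degree ([:1, 1, 1::int:] ^ n) = 2 * n"
  by (simp add: degree_power_eq)

text \<open>The polynomial \<open>1 + x + x^2\<close> is palindromic, and reflection commutes with
  powers.\<close>

lemma trinomial_coeff_symmetric:
  assumes "i \<le> 2 * n"
  shows "trinomial_coeff n (2 * n - i) = trinomial_coeff n i"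
proof -
  have "reflect_poly ([:1, 1, 1::int:] ^ n) = [:1, 1, 1:] ^ n"
    unfolding reflect_poly_power by (simp add: reflect_poly_def)
  then show ?thesis
    using assms coeff_reflect_poly[of "[:1, 1, 1::int:] ^ n" i]
    by (simp add: trinomial_coeff_def degree_trinomial_power)
qed

lemma sum_trinomial_coeff: "(\<Sum>i\<le>2 * n. trinomial_coeff n i) = 3 ^ n"
proof -
  have "poly ([:1, 1, 1::int:] ^ n) 1 = (\<Sum>i\<le>2 * n. trinomial_coeff n i)"
    unfolding poly_altdef degree_trinomial_power trinomial_coeff_def by simp
  then show ?thesis
    by simp
qed

lemma trinomial_coeff_Suc_1_eq: "trinomial_coeff (Suc n) (Suc 0) = int (Suc n)"
  by (induction n) (simp_all add: trinomial_coeff_Suc_1, simp add: trinomial_coeff_def)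

text \<open>Compares coefficients of \<open>x^(i + 1)\<close> in the derivative of
  \<open>(1 + x + x^2)^(n + 1)\<close>.\<close>

lemma times_trinomial_coeff:
  "int (Suc (Suc i)) * trinomial_coeff (Suc n) (Suc (Suc i)) =
     int (Suc n) * (trinomial_coeff n (Suc i) + 2 * trinomial_coeff n i)"
proof -
  have "pderiv ([:1, 1, 1::int:] ^ Suc n) = Polynomial.smult (int (Suc n)) ([:1, 1, 1:] ^ n) * [:1, 2:]"
    unfolding pderiv_power_Suc by (simp add: pderiv_pCons del: power_Suc)
  also have "\<dots> = Polynomial.smult (int (Suc n)) ([:1, 2:] * [:1, 1, 1:] ^ n)"
    by (simp only: mult_smult_left mult.commute[of _ "[:1, 2:]"] mult_smult_right)
  finally have "Polynomial.coeff (pderiv ([:1, 1, 1::int:] ^ Suc n)) (Suc i) =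
      int (Suc n) * Polynomial.coeff ([:1, 2:] * [:1, 1, 1:] ^ n) (Suc i)"
    by (simp only: coeff_smult)
  then show ?thesis
    unfolding trinomial_coeff_def coeff_pderiv by (simp del: power_Suc)
qed

text \<open>By symmetry the coefficients on either side of the centre have equal sums, and all
  together add up to \<open>3 ^ n\<close>.\<close>

lemma twice_sum_trinomial_coeff:
  "2 * (\<Sum>i<n. trinomial_coeff n i) + trinomial_coeff n n = 3 ^ n"
proof -
  have "{..2 * n} = {..<n} \<union> {n} \<union> {n<..2 * n}"
    by auto
  then have "3 ^ n = (\<Sum>i<n. trinomial_coeff n i) + trinomial_coeff n n + (\<Sum>i\<in>{n<..2 * n}. trinomial_coeff n i)"
    unfolding sum_trinomial_coeff[symmetric] by (simp add: sum.union_disjoint ivl_disj_int disjoint_iff)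
  also have "(\<Sum>i\<in>{n<..2 * n}. trinomial_coeff n i) = (\<Sum>i<n. trinomial_coeff n i)"
    by (rule sum.reindex_bij_witness[of _ "\<lambda>i. 2 * n - i" "\<lambda>i. 2 * n - i"])
      (auto simp: trinomial_coeff_symmetric)
  finally show ?thesis
    by simp
qed

text \<open>Each coefficient of the next power is a sum over a window of three consecutive
  coefficients. Windows three apart tile an initial segment; for \<open>e = 1\<close> the first
  window is cut off at index 0.\<close>

lemma sum_trinomial_coeff_class:
  assumes "e \<in> {1, 2}"
  shows "(\<Sum>i\<le>k. trinomial_coeff (Suc n) (3 * i + e)) = (\<Sum>j\<le>3 * k + e. trinomial_coeff n j)"
proof (induction k)
  case 0
  show ?case
    using assms by (auto simp: trinomial_coeff_Suc_1 trinomial_coeff_Suc_Suc numeral_2_eq_2)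
next
  case (Suc k)
  have 3: "3 * Suc k + e = Suc (Suc (Suc (3 * k + e)))"
    by simp
  show ?case
    unfolding sum.atMost_Suc Suc.IH 3 trinomial_coeff_Suc_Suc by simp
qed

section \<open>Trinomial coefficients modulo p and p^2\<close>

lemma coprime_less_prime:
  assumes "prime p" "0 < i" "i < p"
  shows "coprime (int p) (int i)"
  using prime_imp_coprime[of p i] nat_dvd_not_less[of i p] assms by simp

text \<open>The derivative identity gives divisibility of \<open>i\<close> times the coefficient,
  and \<open>i\<close> is prime to \<open>p\<close>. That identity starts at index 2, so
  \<open>i = 1\<close> is separate.\<close>

lemma prime_dvd_trinomial_coeff:
  assumes "prime p" "0 < i" "i < p"
  shows "int p dvd trinomial_coeff p i"
proof -
  obtain n where n: "p = Suc n"
    using gr0_implies_Suc[OF prime_gt_0_nat[OF assms(1)]] by blast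
  have "int p dvd int i * trinomial_coeff p i"
  proof (cases "i = 1")
    case True
    then show ?thesis
      using trinomial_coeff_Suc_1_eq[of n] unfolding n by simp
  next
    case False
    define k where "k = i - 2"
    have "i = Suc (Suc k)"
      using False assms(2) by (simp add: k_def)
    then show ?thesis
      using times_trinomial_coeff[of k n] unfolding n by (simp only: dvd_triv_left)
  qed
  moreover have "coprime (int p) (int i)"
    using assms by (rule coprime_less_prime)
  ultimately show ?thesis
    by (simp add: coprime_dvd_mult_right_iff)
qed

text \<open>The coefficients of the power series \<open>1 / (1 + x + x^2)\<close>, to which
  \<open>(1 + x + x^2)^(p - 1)\<close> reduces modulo \<open>p\<close> below \<open>x^p\<close>.\<close>

definition cyclotomic_inverse_coeff :: "nat \<Rightarrow> int" where
  "cyclotomic_inverse_coeff i = (if i mod 3 = 0 then 1 else if i mod 3 = 1 then - 1 else 0)"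

lemma cyclotomic_inverse_coeff_Suc_Suc:
  "cyclotomic_inverse_coeff (Suc (Suc i)) =
     - cyclotomic_inverse_coeff (Suc i) - cyclotomic_inverse_coeff i"
proof -
  have "i mod 3 = 0 \<or> i mod 3 = 1 \<or> i mod 3 = 2"
    by auto
  then show ?thesis
    unfolding cyclotomic_inverse_coeff_def by (elim disjE) (simp_all add: mod_Suc)
qed

text \<open>The left side is the coefficient of \<open>x^(i + 1)\<close> in
  \<open>(1 + 2 x) / (1 + x + x^2) = 1 / (1 - x) - 3 x^2 / (1 - x^3)\<close>.\<close>

lemma cyclotomic_inverse_coeff_add_twice:
  assumes "Suc (Suc i) mod 3 \<noteq> 0"
  shows "cyclotomic_inverse_coeff (Suc i) + 2 * cyclotomic_inverse_coeff i = 1"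
proof -
  have "i mod 3 = 0 \<or> i mod 3 = 2"
    using assms by presburger
  then show ?thesis
    unfolding cyclotomic_inverse_coeff_def by (elim disjE) (simp_all add: mod_Suc)
qed

text \<open>Modulo the prime, the coefficients of the next power vanish at the indices from 1 to
  \<open>n\<close>, so both sequences obey the same recurrence with the same initial values.\<close>

lemma trinomial_coeff_cong:
  assumes "prime (Suc n)" "i \<le> n"
  shows "[trinomial_coeff n i = cyclotomic_inverse_coeff i] (mod int (Suc n))"
  using assms(2)
proof (induction i rule: less_induct)
  case (less i)
  have Q: "[trinomial_coeff (Suc n) i = 0] (mod int (Suc n))" if "i > 0"
    using prime_dvd_trinomial_coeff[OF assms(1), of i] less.prems that by (simp add: cong_0_iff)
  consider "i = 0" | "i = Suc 0" | j where "i = Suc (Suc j)"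
    using not0_implies_Suc by blast
  then show ?case
  proof cases
    case 1
    then show ?thesis by (simp add: cyclotomic_inverse_coeff_def)
  next
    case 2
    have "[trinomial_coeff (Suc n) i - 1 = 0 - 1] (mod int (Suc n))"
      using 2 by (intro cong_diff cong_refl Q) simp
    then show ?thesis
      using 2 by (simp add: trinomial_coeff_Suc_1 cyclotomic_inverse_coeff_def)
  next
    case 3
    have "[trinomial_coeff (Suc n) i - trinomial_coeff n (Suc j) - trinomial_coeff n j =
        0 - cyclotomic_inverse_coeff (Suc j) - cyclotomic_inverse_coeff j] (mod int (Suc n))"
      using 3 less.prems by (intro cong_diff Q less.IH) simp_all
    then show ?thesis
      using 3 by (simp add: trinomial_coeff_Suc_Suc cyclotomic_inverse_coeff_Suc_Suc)
  qed
qed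

text \<open>Here \<open>w\<close> is the coefficient of \<open>x^(i - 1)\<close> in
  \<open>(1 + 2 x) (1 + x + x^2)^(p - 1)\<close>. Keeping the factor \<open>p\<close> explicit gives
  information modulo \<open>p^2\<close> for \<open>i < p\<close>, and permits cancelling
  \<open>p\<close> when \<open>i = p\<close>.\<close>

lemma times_trinomial_coeff_cong:
  assumes "prime p" "0 < i" "i \<le> p" "i mod 3 \<noteq> 0"
  obtains w where "int i * trinomial_coeff p i = int p * w" "[w = 1] (mod int p)"
proof -
  obtain n where n: "p = Suc n"
    using gr0_implies_Suc[OF prime_gt_0_nat[OF assms(1)]] by blast
  show thesis
  proof (cases "i = 1")
    case True
    then show ?thesis
      using that[of 1] trinomial_coeff_Suc_1_eq[of n] n by simp
  next
    case False
    define k where "k = i - 2"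
    have k: "i = Suc (Suc k)"
      using False assms(2) by (simp add: k_def)
    have "[trinomial_coeff n (Suc k) + 2 * trinomial_coeff n k =
        cyclotomic_inverse_coeff (Suc k) + 2 * cyclotomic_inverse_coeff k] (mod int (Suc n))"
      using assms(1,3) unfolding n k
      by (intro cong_add cong_mult[OF cong_refl] trinomial_coeff_cong) simp_all
    also have "cyclotomic_inverse_coeff (Suc k) + 2 * cyclotomic_inverse_coeff k = 1"
      using assms(4) k by (simp add: cyclotomic_inverse_coeff_add_twice)
    finally show ?thesis
      using that[of "trinomial_coeff n (Suc k) + 2 * trinomial_coeff n k"] times_trinomial_coeff[of k n]
      unfolding n k by (simp only:)
  qed
qed

lemma trinomial_coeff_prime_cong:
  assumes "prime p" "p > 3"
  shows "[trinomial_coeff p p = 1] (mod int p)"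
proof -
  have "\<not> 3 dvd p"
  proof
    assume "3 dvd p"
    then show False
      using assms(2) primes_dvd_imp_eq[of 3 p] assms(1) by simp
  qed
  then have "p mod 3 \<noteq> 0"
    unfolding dvd_eq_mod_eq_0 .
  then obtain w where w: "int p * trinomial_coeff p p = int p * w" "[w = 1] (mod int p)"
    by (rule times_trinomial_coeff_cong[OF assms(1) prime_gt_0_nat[OF assms(1)] order_refl])
  then have "trinomial_coeff p p = w"
    using assms(2) by simp
  with w(2) show ?thesis
    by (simp only:)
qed

text \<open>The two coefficients are \<open>p / i\<close> and \<open>p / j\<close> modulo
  \<open>p^2\<close>, and \<open>p / i + p / j = p^2 / (i j)\<close>.\<close>

lemma prime_square_dvd_trinomial_coeff_add:
  assumes "prime p" "0 < i" "0 < j" "i + j = p" "i mod 3 \<noteq> 0" "j mod 3 \<noteq> 0"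
  shows "(int p)\<^sup>2 dvd trinomial_coeff p i + trinomial_coeff p j"
proof -
  obtain v where v: "int i * trinomial_coeff p i = int p * v" "[v = 1] (mod int p)"
    by (rule times_trinomial_coeff_cong[of p i]) (use assms in simp_all)
  obtain w where w: "int j * trinomial_coeff p j = int p * w" "[w = 1] (mod int p)"
    by (rule times_trinomial_coeff_cong[of p j]) (use assms in simp_all)
  have "[int j * v + int i * w = int j * 1 + int i * 1] (mod int p)"
    using v w by (intro cong_add cong_mult cong_refl)
  then have "int p dvd int j * v + int i * w"
    using assms(4) by (auto simp: cong_dvd_iff add.commute)
  moreover have "int i * int j * (trinomial_coeff p i + trinomial_coeff p j) =
      int j * (int i * trinomial_coeff p i) + int i * (int j * trinomial_coeff p j)"
    by (simp add: algebra_simps)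
  then have "int i * int j * (trinomial_coeff p i + trinomial_coeff p j) = int p * (int j * v + int i * w)"
    unfolding v w by (simp add: algebra_simps)
  ultimately have "(int p)\<^sup>2 dvd int i * int j * (trinomial_coeff p i + trinomial_coeff p j)"
    by (simp add: power2_eq_square)
  moreover have "coprime ((int p)\<^sup>2) (int i * int j)"
    using coprime_less_prime[of p i] coprime_less_prime[of p j] assms by simp
  ultimately show ?thesis
    by (simp add: coprime_dvd_mult_right_iff)
qed

text \<open>Writing \<open>p = 3 k + 2 e\<close> makes the residue class of \<open>e\<close> modulo
  3 stable under \<open>i \<mapsto> p - i\<close>.\<close>

lemma central_trinomial_coeff_prime_pred:
  assumes "prime p" "p = 3 * k + 2 * e" "e \<in> {1, 2}"
  shows "[trinomial_coeff (p - 1) (p - 1) = (if e = 1 then - 1 else 1) * 3 ^ (p - 1)] (mod (int p)\<^sup>2)"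
proof -
  define W where "W = (\<Sum>i\<le>k. trinomial_coeff p (3 * i + e))"
  obtain n where n: "p = Suc n"
    using gr0_implies_Suc[OF prime_gt_0_nat[OF assms(1)]] by blast
  \<comment> \<open>Reversing the sum pairs each index with its complement to
    \<open>p\<close>.\<close>
  have "W = (\<Sum>i\<le>k. trinomial_coeff p (3 * (k - i) + e))"
    unfolding W_def by (rule sum.reindex_bij_witness[of _ "\<lambda>i. k - i" "\<lambda>i. k - i"]) auto
  then have "2 * W = (\<Sum>i\<le>k. trinomial_coeff p (3 * i + e) + trinomial_coeff p (3 * (k - i) + e))"
    by (simp add: sum.distrib W_def)
  also have "(int p)\<^sup>2 dvd \<dots>"
    using assms by (intro dvd_sum prime_square_dvd_trinomial_coeff_add) auto
  finally have dvd: "(int p)\<^sup>2 dvd 2 * W" .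
  \<comment> \<open>As \<open>3 k + e = p - e\<close>, this partial sum ends at the central index
    \<open>n\<close> if \<open>e = 1\<close> and just before it if \<open>e = 2\<close>; hence the
    sign.\<close>
  have W: "W = (\<Sum>j\<le>3 * k + e. trinomial_coeff n j)"
    unfolding W_def n using assms(3) by (rule sum_trinomial_coeff_class)
  have *: "2 * (\<Sum>j<n. trinomial_coeff n j) + trinomial_coeff n n = 3 ^ n"
    by (rule twice_sum_trinomial_coeff)
  show ?thesis
  proof (cases "e = 1")
    case True
    then have "{..3 * k + e} = insert n {..<n}"
      using n assms(2) by auto
    then have "trinomial_coeff n n - (- 1) * 3 ^ n = 2 * W"
      using * W by simp
    then show ?thesis
      using dvd n True by (simp add: cong_iff_dvd_diff)
  next
    case False
    then have "{..3 * k + e} = {..<n}"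
      using n assms by auto
    then have "trinomial_coeff n n - 3 ^ n = - (2 * W)"
      using * W by simp
    then show ?thesis
      using dvd n False by (simp add: cong_iff_dvd_diff)
  qed
qed

section \<open>The ring of rationals with denominator prime to p\<close>

text \<open>The reduced denominator divides every other one, so any representation with denominator
  prime to \<open>p\<close> will do. Closure under the ring operations then needs no reduction of
  fractions.\<close>

lemma denom_prime_to_iff:
  "denom_prime_to p x \<longleftrightarrow> (\<exists>a b. coprime b (int p) \<and> b \<noteq> 0 \<and> x = of_int a / of_int b)"
proof
  assume *: "denom_prime_to p x"
  obtain n d where q: "quotient_of x = (n, d)"
    by fastforce
  have "x = of_int n / of_int d" "d \<noteq> 0" "coprime d (int p)"
    using quotient_of_div[OF q] quotient_of_denom_pos[OF q] * q by (auto simp: denom_prime_to_def)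
  then show "\<exists>a b. coprime b (int p) \<and> b \<noteq> 0 \<and> x = of_int a / of_int b"
    by blast
next
  assume "\<exists>a b. coprime b (int p) \<and> b \<noteq> 0 \<and> x = of_int a / of_int b"
  then obtain a b where ab: "coprime b (int p)" "b \<noteq> 0" "x = of_int a / of_int b"
    by blast
  obtain n d where q: "quotient_of x = (n, d)"
    by fastforce
  have nd: "x = of_int n / of_int d" "d > 0" "coprime n d"
    using quotient_of_div[OF q] quotient_of_denom_pos[OF q] quotient_of_coprime[OF q] by auto
  then have "(of_int (n * b) :: rat) = of_int (a * d)"
    using ab by (simp add: field_simps)
  then have "n * b = a * d"
    by (simp only: of_int_eq_iff)
  then have "d dvd n * b"
    by simp
  then have "d dvd b"
    using nd(3) by (simp add: coprime_commute coprime_dvd_mult_right_iff)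
  then show "denom_prime_to p x"
    using q ab(1) coprime_divisors[of d b "int p" "int p"] by (simp add: denom_prime_to_def)
qed

lemma denom_prime_to_divide_int:
  assumes "coprime b (int p)" "b \<noteq> 0"
  shows "denom_prime_to p (of_int a / of_int b)"
  using assms denom_prime_to_iff by blast

lemma denom_prime_to_of_int: "denom_prime_to p (of_int a)"
  using denom_prime_to_divide_int[of 1 p a] by simp

lemma denom_prime_to_add:
  assumes "denom_prime_to p x" "denom_prime_to p y"
  shows "denom_prime_to p (x + y)"
proof -
  obtain a b c d where *: "coprime b (int p)" "b \<noteq> 0" "x = of_int a / of_int b"
      "coprime d (int p)" "d \<noteq> 0" "y = of_int c / of_int d"
    using assms unfolding denom_prime_to_iff by blast
  then have "x + y = of_int (a * d + c * b) / of_int (b * d)"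
    by (simp add: field_simps)
  then show ?thesis
    using * denom_prime_to_divide_int[of "b * d" p "a * d + c * b"] by simp
qed

lemma denom_prime_to_mult:
  assumes "denom_prime_to p x" "denom_prime_to p y"
  shows "denom_prime_to p (x * y)"
proof -
  obtain a b c d where *: "coprime b (int p)" "b \<noteq> 0" "x = of_int a / of_int b"
      "coprime d (int p)" "d \<noteq> 0" "y = of_int c / of_int d"
    using assms unfolding denom_prime_to_iff by blast
  then have "x * y = of_int (a * c) / of_int (b * d)"
    by simp
  then show ?thesis
    using * denom_prime_to_divide_int[of "b * d" p "a * c"] by simp
qed

lemma denom_prime_to_diff:
  assumes "denom_prime_to p x" "denom_prime_to p y"
  shows "denom_prime_to p (x - y)"
  using denom_prime_to_add[OF assms(1) denom_prime_to_mult[OF denom_prime_to_of_int[of p "- 1"] assms(2)]]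
  by simp

lemma denom_prime_to_sum:
  assumes "\<And>i. i \<in> A \<Longrightarrow> denom_prime_to p (f i)"
  shows "denom_prime_to p (\<Sum>i\<in>A. f i)"
  using assms
proof (induction A rule: infinite_finite_induct)
  case (insert i A)
  then show ?case
    by (simp add: denom_prime_to_add)
qed (use denom_prime_to_of_int[of p 0] in simp_all)

text \<open>The equation passes integrality at \<open>p\<close> from \<open>b\<close> and
  \<open>c\<close> on to \<open>a\<close>, so exhibiting the cofactor \<open>c\<close> settles all
  three conditions.\<close>

lemma rat_cong_powI:
  assumes "denom_prime_to p b" "denom_prime_to p c" "a = b + of_nat p ^ r * c" "p > 0"
  shows "rat_cong_pow p r a b"
proof -
  have "denom_prime_to p (of_nat p ^ r)"
    using denom_prime_to_of_int[of p "int p ^ r"] by simp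
  then show ?thesis
    using assms unfolding rat_cong_pow_def by (simp add: denom_prime_to_add denom_prime_to_mult)
qed

text \<open>Pairing \<open>j\<close> with \<open>p - j\<close> works, since
  \<open>1 / j + 1 / (p - j) = p / (j (p - j))\<close>.\<close>

lemma denom_prime_to_harmonic_div:
  assumes "prime p" "p > 2"
  shows "denom_prime_to p (harmonic (p - 1) / of_nat p)"
proof -
  have "harmonic (p - 1) = (\<Sum>j = 1..p - 1. 1 / of_nat (p - j))"
    unfolding harmonic_def
    by (rule sum.reindex_bij_witness[of _ "\<lambda>j. p - j" "\<lambda>j. p - j"]) auto
  then have "2 * harmonic (p - 1) = (\<Sum>j = 1..p - 1. 1 / of_nat j + 1 / of_nat (p - j))"
    by (simp add: sum.distrib harmonic_def)
  also have "\<dots> = of_nat p * (\<Sum>j = 1..p - 1. of_int 1 / of_int (int j * int (p - j)))"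
    unfolding sum_distrib_left
    by (intro sum.cong refl) (auto simp: field_simps of_nat_diff)
  finally have "harmonic (p - 1) / of_nat p =
      of_int 1 / of_int 2 * (\<Sum>j = 1..p - 1. of_int 1 / of_int (int j * int (p - j)))"
    using assms(2) by (simp add: field_simps)
  also have "denom_prime_to p \<dots>"
  proof (intro denom_prime_to_mult denom_prime_to_sum denom_prime_to_divide_int)
    show "coprime 2 (int p)"
      using coprime_less_prime[of p 2] assms by (simp add: coprime_commute)
    fix j assume "j \<in> {1..p - 1}"
    then have j: "0 < j" "j < p"
      by auto
    then show "int j * int (p - j) \<noteq> 0"
      by simp
    show "coprime (int j * int (p - j)) (int p)"
      using coprime_less_prime[of p j] coprime_less_prime[of p "p - j"] assms(1) j
      by (simp add: coprime_commute)
  qed simp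
  finally show ?thesis .
qed

section \<open>The Legendre symbol modulo 3\<close>

lemma QuadRes_3_1: "QuadRes 3 1"
  unfolding QuadRes_def by (rule exI[of _ 1]) simp

lemma not_QuadRes_3_2: "\<not> QuadRes 3 2"
proof
  assume "QuadRes 3 2"
  then obtain y :: int where y: "y\<^sup>2 mod 3 = 2"
    unfolding QuadRes_def cong_def by auto
  have "y mod 3 = 0 \<or> y mod 3 = 1 \<or> y mod 3 = 2"
    by presburger
  moreover have "y\<^sup>2 mod 3 = (y mod 3)\<^sup>2 mod 3"
    by (simp add: power_mod)
  ultimately show False
    using y by auto
qed

lemma Legendre_3_right:
  "Legendre a 3 = (if a mod 3 = 0 then 0 else if a mod 3 = 1 then 1 else - 1)"
proof -
  have QR: "QuadRes 3 a \<longleftrightarrow> QuadRes 3 (a mod 3)"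
    unfolding QuadRes_def cong_def by simp
  have "a mod 3 = 0 \<or> a mod 3 = 1 \<or> a mod 3 = 2"
    by presburger
  then show ?thesis
    unfolding Legendre_def QR cong_def using QuadRes_3_1 not_QuadRes_3_2 by auto
qed

section \<open>The exact evaluation combined with the three congruences\<close>

theorem theorem1p2:
  fixes p :: nat
  assumes "prime p" and "p > 3"
  shows "rat_cong_pow p 2
           (\<Sum>k = 0..p - 1. of_int (central_trinomial k) * harmonic k / 3 ^ k)
           ((3 + of_int (Legendre (int p) 3)) / 2 - of_nat p * (1 + of_int (Legendre (int p) 3)))"
proof -
  obtain n where n: "p = Suc n"
    using gr0_implies_Suc[OF prime_gt_0_nat[OF assms(1)]] by blast
  define \<epsilon> where "\<epsilon> = Legendre (int p) 3"
  define s where "s = scaled_trinomial n"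
  define t where "t = scaled_trinomial p"
  have T: "central_trinomial m = trinomial_coeff m m" for m
    by (simp add: central_trinomial_def trinomial_coeff_def)
  have "\<not> 3 dvd p"
    using assms primes_dvd_imp_eq[of 3 p] by auto
  then have "p mod 3 = 1 \<or> p mod 3 = 2"
    by presburger
  then have "[central_trinomial n = \<epsilon> * 3 ^ n] (mod (int p)\<^sup>2)"
  proof
    assume 1: "p mod 3 = 1"
    \<comment> \<open>With \<open>q = p div 3\<close> one has
      \<open>p = 3 q + 1 = 3 (q - 1) + 4\<close>; the bound \<open>p > 3\<close> ensures
      \<open>q \<ge> 1\<close>.\<close>
    then obtain k where "p = 3 * k + 2 * 2"
      using assms(2) by (intro that[of "p div 3 - 1"]) presburger
    moreover have "\<epsilon> = 1"
      using 1 zmod_int[of p 3] by (simp add: \<epsilon>_def Legendre_3_right)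
    ultimately show ?thesis
      using central_trinomial_coeff_prime_pred[of p k 2] assms(1) n by (simp add: T)
  next
    assume 2: "p mod 3 = 2"
    then obtain k where "p = 3 * k + 2 * 1"
      by (intro that[of "p div 3"]) presburger
    moreover have "\<epsilon> = - 1"
      using 2 zmod_int[of p 3] by (simp add: \<epsilon>_def Legendre_3_right)
    ultimately show ?thesis
      using central_trinomial_coeff_prime_pred[of p k 1] assms(1) n by (simp add: T)
  qed
  then have "[\<epsilon> * 3 ^ n = central_trinomial n] (mod (int p)\<^sup>2)"
    by (rule cong_sym)
  then obtain u where u: "central_trinomial n = \<epsilon> * 3 ^ n + (int p)\<^sup>2 * u"
    unfolding cong_iff_lin by blast
  \<comment> \<open>Fermat's little theorem replaces 1 by \<open>3 ^ n\<close>, the denominator of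
    \<open>3 t\<close>.\<close>
  have "[int (3 ^ n) = int 1] (mod int p)"
    using fermat_theorem[OF assms(1), of 3] nat_dvd_not_less[of 3 p] assms(2) n unfolding cong_int_iff by simp
  then have "[3 ^ n = central_trinomial p] (mod int p)"
    using trinomial_coeff_prime_cong[OF assms] by (simp add: T cong_def)
  then obtain v where v: "central_trinomial p = 3 ^ n + int p * v"
    by (auto simp: cong_iff_lin)
  have coprime_3: "coprime ((3::int) ^ n) (int p)"
    using coprime_less_prime[of p 3] assms by (simp add: coprime_commute)
  \<comment> \<open>Together with \<open>h\<close>, these are the cofactors that turn the
    congruences for \<open>s\<close>, \<open>3 t\<close> and \<open>p H p\<close> into exact
    identities.\<close>
  define u' v' :: rat where "u' = of_int u / of_int (3 ^ n)" and "v' = of_int v / of_int (3 ^ n)"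
  define h where "h = harmonic n / of_nat p"
  have s: "s = of_int \<epsilon> + of_nat p ^ 2 * u'"
    by (simp add: s_def scaled_trinomial_def u u'_def field_simps)
  have t: "3 * t = 1 + of_nat p * v'"
  proof -
    have "3 * t = of_int (central_trinomial p) / 3 ^ n"
      by (simp add: t_def scaled_trinomial_def n)
    then show ?thesis
      by (simp add: v v'_def field_simps)
  qed
  have p0: "(of_nat p :: rat) \<noteq> 0"
    using n by simp
  have H: "of_nat p * harmonic p = 1 + of_nat p ^ 2 * h"
    using p0 by (simp add: n harmonic_Suc h_def field_simps power2_eq_square)
  have "(\<Sum>k = 0..p - 1. of_int (central_trinomial k) * harmonic k / 3 ^ k) =
      (\<Sum>k<Suc n. scaled_trinomial k * harmonic k)"
    unfolding n by (intro sum.cong) (auto simp: scaled_trinomial_def)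
  also have "\<dots> = (of_nat p * harmonic p / 2 - of_nat p) * (3 * t + s) - (3 * t - 3) / 2"
    unfolding sum_scaled_trinomial_harmonic s_def t_def n by (simp add: algebra_simps)
  \<comment> \<open>The two terms \<open>p v' / 2\<close> cancel, which is why \<open>3 t\<close> is
    needed only modulo \<open>p\<close>.\<close>
  also have "\<dots> = ((3 + of_int \<epsilon>) / 2 - of_nat p * (1 + of_int \<epsilon>)) +
      of_nat p ^ 2 * (h / 2 * (3 * t + s) + (1 / 2 - of_nat p) * u' - v')"
    unfolding H s t by (simp add: field_simps power2_eq_square)
  finally have eq: "(\<Sum>k = 0..p - 1. of_int (central_trinomial k) * harmonic k / 3 ^ k) = \<dots>" .
  have half: "denom_prime_to p (a / 2)" if "denom_prime_to p a" for a
    using denom_prime_to_mult[OF that denom_prime_to_divide_int[of 2 p 1]] coprime_less_prime[of p 2] assms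
    by (simp add: coprime_commute)
  have ints: "denom_prime_to p 1" "denom_prime_to p 3" "denom_prime_to p (of_nat p)"
    using denom_prime_to_of_int[of p 1] denom_prime_to_of_int[of p 3] denom_prime_to_of_int[of p "int p"]
    by simp_all
  have uv: "denom_prime_to p u'" "denom_prime_to p v'"
    unfolding u'_def v'_def by (simp_all only: denom_prime_to_divide_int[OF coprime_3 power_not_zero[OF zero_neq_numeral[symmetric]]])
  have h: "denom_prime_to p h"
    using denom_prime_to_harmonic_div[of p] assms n by (simp add: h_def)
  note closure = denom_prime_to_add denom_prime_to_mult denom_prime_to_diff half ints uv h denom_prime_to_of_int
  show ?thesis
    using eq unfolding \<epsilon>_def[symmetric]
  proof (rule rat_cong_powI[rotated 2])
    show "denom_prime_to p ((3 + of_int \<epsilon>) / 2 - of_nat p * (1 + of_int \<epsilon>))"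
      by (intro closure)
    show "denom_prime_to p (h / 2 * (3 * t + s) + (1 / 2 - of_nat p) * u' - v')"
      unfolding s t power2_eq_square by (intro closure)
    show "p > 0"
      using n by simp
  qed
qed

end
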